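(* Let $\Delta$ be a simplicial complex on a finite set of vertices $V=\{v_1,v_2,\ldots,v_n\}$, and let $P\subseteq \mathbb{Z}_{\ge 0}^n$ be the set of $\mathcal{P}$-positions of nim on $\Delta$. Let $G=(g_1,g_2,\ldots,g_n)$ be a collection of positions of impartial games. Then the simplicial emperor sum $\Delta(G)$ is a $\mathcal{P}$-position if and only if $(\mathrm{Pl}(g_1),\mathrm{Pl}(g_2),\ldots,\mathrm{Pl}(g_n))\in P$ and $g_i$ is a $\mathcal{P}$-position for every $i\in\{1,\ldots,n\}$.
   Context: Games: All games are two-player perfect-information games without chance moves, and are impartial (both players have the same set of options at each position). They are played under the normal play convention (the player who makes the last move wins, so a player unable to move loses). They are loop-free (a position occurs at most once in a play), and every play ends after finitely many moves. An option of a position $g$ is a position reached by one move from $g$. A strict follower of $g$ is a position reached from $g$ by one or more successive moves, where consecutive moves are counted without regard to which player makes them. A terminal position is one with no options. A position is a $\mathcal{P}$-position if the previous player (the one not about to move) has a winning strategy, and an $\mathcal{N}$-position if the next player (the one about to move) has a winning strategy. Each position is exactly one of the two. Simplicial complex: A simplicial complex $\Delta$ on a finite set $V$ is a subset of $2^V$ such that $\{v\}\in\Delta$ for every $v\in V$, and if $F\in\Delta$ and $F'\subseteq F$ then $F'\in\Delta$. Elements of $\Delta$ are called faces. Nim on $\Delta$: A position is a tuple $(a_1,\ldots,a_n)$ of non-negative integers, with $a_i$ the number of stones on vertex $v_i$. A move consists of choosing a non-empty face $F\in\Delta$ and removing a positive number of stones from each vertex in $F$ (the numbers may be chosen independently for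 the different vertices of $F$), leaving all vertices not in $F$ unchanged. So the options of $(a_1,\ldots,a_n)$ are the tuples $(a_1',\ldots,a_n')$ of non-negative integers for which there is a non-empty face $F$ with $a_i'<a_i$ for all $v_i\in F$ and $a_i'=a_i$ for all $v_i\notin F$. Normal play is used. Simplicial emperor sum: For a collection $G=(g_1,\ldots,g_n)$ of positions of impartial games, $\Delta(G)$ is the position in which $g_i$ is placed on vertex $v_i$. The player to move chooses a face $F\in\Delta$ and makes an arbitrary number of successive moves (possibly zero) in the position on each vertex of $F$. In addition, in the position on each vertex not in $F$, the player makes at most one move. At least one move must be made in total. So the options of $\Delta(G)$ are the positions $\Delta(g_1',\ldots,g_n')$ with $(g_1',\ldots,g_n')\neq(g_1,\ldots,g_n)$ for which there is a face $F\in\Delta$ such that $g_i'$ is equal to $g_i$ or a strict follower of $g_i$ for each $v_i\in F$, and $g_i'$ is equal to $g_i$ or an option of $g_i$ for each $v_i\notin F$. Normal play is used. $\mathcal{P}$-position length: For a position $g$ of an impartial game, $\mathrm{Pl}(g)=0$ if $g$ is terminal, and otherwise $\mathrm{Pl}(g)=\max\{\mathrm{Pl}(g') : g' \text{ is a } \mathcal{P}\text{-position and a strict follower of } g\}+1$. It is assumed that these maxima exist, so that $\mathrm{Pl}$ is a well-defined non-negative integer (this is automatic if each position has only finitely many strict followers). *)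

theory Defs
  imports Main
begin

text \<open>
  An impartial game is given by its option function, which sends a position to the set of
  positions reachable from it by one move.
\<close>

definition terminating :: "('p \<Rightarrow> 'p set) \<Rightarrow> bool" where
  "terminating opts \<longleftrightarrow> wfp (\<lambda>h g. h \<in> opts g)"

definition strict_follower :: "('p \<Rightarrow> 'p set) \<Rightarrow> 'p \<Rightarrow> 'p \<Rightarrow> bool" where
  "strict_follower opts = (\<lambda>g h. h \<in> opts g)\<^sup>+\<^sup>+"

text \<open>
  A play is recorded as the list of the positions visited. Move number \<open>k\<close>, counted from 0, leads
  from \<open>ps ! k\<close> to \<open>ps ! Suc k\<close>; the player about to move at the start makes the even moves.
\<close>

datatype player = Next | Previous

definition mover :: "nat \<Rightarrow> player" where
  "mover k = (if even k then Next else Previous)"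

definition complete_play :: "('p \<Rightarrow> 'p set) \<Rightarrow> 'p \<Rightarrow> 'p list \<Rightarrow> bool" where
  "complete_play opts g ps \<longleftrightarrow>
     ps \<noteq> [] \<and> hd ps = g \<and> successively (\<lambda>x y. y \<in> opts x) ps \<and> opts (last ps) = {}"

text \<open>
  A strategy maps the nonempty history of a play to the next position. Without the requirement that
  it chooses an option whenever there is one, a strategy could win vacuously by choosing illegal
  moves.
\<close>

definition strategy :: "('p \<Rightarrow> 'p set) \<Rightarrow> ('p list \<Rightarrow> 'p) \<Rightarrow> bool" where
  "strategy opts \<sigma> \<longleftrightarrow> (\<forall>ps. ps \<noteq> [] \<and> opts (last ps) \<noteq> {} \<longrightarrow> \<sigma> ps \<in> opts (last ps))"

definition follows :: "player \<Rightarrow> ('p list \<Rightarrow> 'p) \<Rightarrow> 'p list \<Rightarrow> bool" where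
  "follows pl \<sigma> ps \<longleftrightarrow>
     (\<forall>k. Suc k < length ps \<and> mover k = pl \<longrightarrow> ps ! Suc k = \<sigma> (take (Suc k) ps))"

text \<open>In a complete play, the player whose turn it is at the end is unable to move and loses.\<close>

definition wins :: "player \<Rightarrow> 'p list \<Rightarrow> bool" where
  "wins pl ps \<longleftrightarrow> mover (length ps - 1) \<noteq> pl"

definition has_winning_strategy :: "('p \<Rightarrow> 'p set) \<Rightarrow> player \<Rightarrow> 'p \<Rightarrow> bool" where
  "has_winning_strategy opts pl g \<longleftrightarrow>
     (\<exists>\<sigma>. strategy opts \<sigma> \<and>
        (\<forall>ps. complete_play opts g ps \<and> follows pl \<sigma> ps \<longrightarrow> wins pl ps))"

definition P_position :: "('p \<Rightarrow> 'p set) \<Rightarrow> 'p \<Rightarrow> bool" where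
  "P_position opts g \<longleftrightarrow> has_winning_strategy opts Previous g"

definition P_followers :: "('p \<Rightarrow> 'p set) \<Rightarrow> 'p \<Rightarrow> 'p set" where
  "P_followers opts g = {h. strict_follower opts g h \<and> P_position opts h}"

definition Pl :: "('p \<Rightarrow> 'p set) \<Rightarrow> 'p \<Rightarrow> nat" where
  "Pl opts = wfrec {(h, g). strict_follower opts g h}
     (\<lambda>pl g. if opts g = {} then 0 else Max (pl ` P_followers opts g) + 1)"

lemma Pl_rec:
  assumes "terminating opts"
  shows "Pl opts g = (if opts g = {} then 0 else Max (Pl opts ` P_followers opts g) + 1)"
proof -
  have "wfp (\<lambda>h g. h \<in> opts g)\<^sup>+\<^sup>+"
    using assms by (simp add: terminating_def wfp_tranclp)
  moreover have "(\<lambda>h g. h \<in> opts g)\<^sup>+\<^sup>+ = (\<lambda>h g. strict_follower opts g h)"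
  proof -
    have "(\<lambda>h g. h \<in> opts g) = (\<lambda>g h. h \<in> opts g)\<inverse>\<inverse>"
      by (simp add: fun_eq_iff)
    then show ?thesis
      by (simp only: tranclp_converse strict_follower_def) (simp add: fun_eq_iff)
  qed
  ultimately have wf: "wf {(h, g). strict_follower opts g h}"
    by (simp add: wfp_def)
  have cut: "cut f {(h, g). strict_follower opts g h} g ` P_followers opts g = f ` P_followers opts g"
    for f :: "_ \<Rightarrow> nat"
    by (rule image_cong) (auto simp: cut_apply P_followers_def)
  show ?thesis
    unfolding Pl_def by (subst wfrec[OF wf]) (simp only: cut)
qed

text \<open>
  \<^const>\<open>Max\<close> is unspecified on infinite sets, so the existence of all the maxima entering into
  the recursion for a position is a separate condition.
\<close>

definition Pl_well_defined :: "('p \<Rightarrow> 'p set) \<Rightarrow> 'p \<Rightarrow> bool" where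
  "Pl_well_defined opts g \<longleftrightarrow>
     (\<forall>h. (h = g \<or> strict_follower opts g h) \<and> opts h \<noteq> {} \<longrightarrow>
        (\<exists>m \<in> Pl opts ` P_followers opts h. \<forall>n \<in> Pl opts ` P_followers opts h. n \<le> m))"

definition simplicial_complex_on :: "'v set \<Rightarrow> 'v set set \<Rightarrow> bool" where
  "simplicial_complex_on V \<Delta> \<longleftrightarrow>
     \<Delta> \<subseteq> Pow V \<and> (\<forall>v\<in>V. {v} \<in> \<Delta>) \<and> (\<forall>F\<in>\<Delta>. \<forall>F'. F' \<subseteq> F \<longrightarrow> F' \<in> \<Delta>)"

text \<open>
  Tuples indexed by the vertex set \<open>V\<close> are functions on the type of vertices. No move changes a value
  outside \<open>V\<close>, so these values are irrelevant.
\<close>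

definition nim_opts :: "'v set set \<Rightarrow> ('v \<Rightarrow> nat) \<Rightarrow> ('v \<Rightarrow> nat) set" where
  "nim_opts \<Delta> a =
     {a'. \<exists>F\<in>\<Delta>. F \<noteq> {} \<and> (\<forall>v\<in>F. a' v < a v) \<and> (\<forall>v. v \<notin> F \<longrightarrow> a' v = a v)}"

definition nim_P_positions :: "'v set set \<Rightarrow> ('v \<Rightarrow> nat) set" where
  "nim_P_positions \<Delta> = {a. P_position (nim_opts \<Delta>) a}"

text \<open>Each vertex \<open>v\<close> carries a game of its own, with option function \<open>opts v\<close>.\<close>

definition emperor_opts ::
    "'v set \<Rightarrow> 'v set set \<Rightarrow> ('v \<Rightarrow> 'p \<Rightarrow> 'p set) \<Rightarrow> ('v \<Rightarrow> 'p) \<Rightarrow> ('v \<Rightarrow> 'p) set" where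
  "emperor_opts V \<Delta> opts g =
     {g'. g' \<noteq> g \<and> (\<forall>v. v \<notin> V \<longrightarrow> g' v = g v) \<and>
        (\<exists>F\<in>\<Delta>. (\<forall>v\<in>F. g' v = g v \<or> strict_follower (opts v) (g v) (g' v)) \<and>
               (\<forall>v\<in>V - F. g' v = g v \<or> g' v \<in> opts v (g v)))}"

end

theory Submission
  imports Defs
begin

text \<open>
  The positions all of whose components are P-positions and whose tuple of P-position lengths is
  a P-position of nim form a kernel of the emperor sum. No move joins two of them: a component
  between whose old and new values there is a single move cannot be a P-position both times, so
  exactly the components on some face change, and there the length drops, which is a nim move.
  From any other position first make one move to a P-position in each component that is an
  N-position. If the resulting lengths are not a P-position of nim, correct them by a nim move to
  one: on its face, every smaller length is attained by a P-position that is a strict follower.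
\<close>

section \<open>Outcomes and strategies\<close>

text \<open>Strategy-free labels obtained by backward induction, with normal play built in: a
  terminal position is \<open>lost\<close> vacuously. Their recursive equations carry the later
  arguments, once strategies have been matched to them.\<close>

inductive lost :: "('p \<Rightarrow> 'p set) \<Rightarrow> 'p \<Rightarrow> bool"
  and won :: "('p \<Rightarrow> 'p set) \<Rightarrow> 'p \<Rightarrow> bool"
  for opts where
  lostI: "(\<And>h. h \<in> opts g \<Longrightarrow> won opts h) \<Longrightarrow> lost opts g"
| wonI: "h \<in> opts g \<Longrightarrow> lost opts h \<Longrightarrow> won opts g"

lemma lost_iff: "lost opts g \<longleftrightarrow> (\<forall>h\<in>opts g. won opts h)"
  by (subst lost.simps) auto

lemma won_iff: "won opts g \<longleftrightarrow> (\<exists>h\<in>opts g. lost opts h)"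
  by (subst won.simps) auto

lemma won_iff_not_lost:
  assumes "terminating opts"
  shows "won opts g \<longleftrightarrow> \<not> lost opts g"
  using assms unfolding terminating_def
proof (induction g rule: wfp_induct_rule)
  case (less g)
  then show ?case
    by (metis lost_iff won_iff)
qed

text \<open>The second branch only keeps the strategy legal: \<open>strategy\<close> demands an
  option at every nonterminal position, even one where the mover cannot force a win.\<close>

definition optimal_strategy :: "('p \<Rightarrow> 'p set) \<Rightarrow> 'p list \<Rightarrow> 'p" where
  "optimal_strategy opts ps =
     (if won opts (last ps) then SOME h. h \<in> opts (last ps) \<and> lost opts h
      else SOME h. h \<in> opts (last ps))"

lemma optimal_strategy_won:
  assumes "won opts (last ps)"
  shows "optimal_strategy opts ps \<in> opts (last ps)" "lost opts (optimal_strategy opts ps)"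
proof -
  have "\<exists>h. h \<in> opts (last ps) \<and> lost opts h"
    using assms by (auto simp: won_iff)
  from someI_ex[OF this] assms
  show "optimal_strategy opts ps \<in> opts (last ps)" "lost opts (optimal_strategy opts ps)"
    by (simp_all add: optimal_strategy_def)
qed

lemma strategy_optimal_strategy: "strategy opts (optimal_strategy opts)"
  unfolding strategy_def
proof (intro allI impI)
  fix ps
  assume ps: "ps \<noteq> [] \<and> opts (last ps) \<noteq> {}"
  show "optimal_strategy opts ps \<in> opts (last ps)"
  proof (cases "won opts (last ps)")
    case True
    then show ?thesis by (rule optimal_strategy_won)
  next
    case False
    then show ?thesis
      using ps by (auto simp: optimal_strategy_def intro: someI)
  qed
qed

lemma mover_Suc_eq: "mover (Suc k) = pl \<longleftrightarrow> mover k \<noteq> pl"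
  by (cases pl) (auto simp: mover_def)

text \<open>Along the play, \<open>won\<close> holds whenever \<open>pl\<close> is to move and
  \<open>lost\<close> otherwise. The final position has no options, hence is not \<open>won\<close>,
  so it is the opponent who is stuck there.\<close>

lemma optimal_strategy_wins:
  assumes play: "complete_play opts g ps" and follows: "follows pl (optimal_strategy opts) ps"
    and start: "if pl = Next then won opts g else lost opts g"
  shows "wins pl ps"
proof -
  have ne: "ps \<noteq> []" and hd: "hd ps = g" and end_opts: "opts (last ps) = {}"
    and succ: "\<And>k. Suc k < length ps \<Longrightarrow> ps ! Suc k \<in> opts (ps ! k)"
    using play by (auto simp: complete_play_def successively_conv_nth)
  have inv: "if mover k = pl then won opts (ps ! k) else lost opts (ps ! k)"
    if "k < length ps" for k
    using that
  proof (induction k)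
    case 0
    then show ?case
      using start hd ne by (cases pl) (auto simp: mover_def hd_conv_nth)
  next
    case (Suc k)
    \<comment> \<open>The history shown to the strategy before move \<open>k\<close> has
      \<open>Suc k\<close> entries and ends in the current position.\<close>
    have last: "last (take (Suc k) ps) = ps ! k"
      using Suc.prems by (simp add: take_Suc_conv_app_nth)
    show ?case
    proof (cases "mover k = pl")
      case True
      then have "ps ! Suc k = optimal_strategy opts (take (Suc k) ps)"
        using follows Suc.prems by (simp add: follows_def)
      moreover have "won opts (last (take (Suc k) ps))"
        using Suc True last by simp
      ultimately have "lost opts (ps ! Suc k)"
        by (metis optimal_strategy_won(2))
      then show ?thesis
        using True mover_Suc_eq[of k pl] by simp
    next
      case False
      then have "lost opts (ps ! k)"
        using Suc by simp
      then have "won opts (ps ! Suc k)"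
        using succ[OF Suc.prems] by (simp add: lost_iff)
      then show ?thesis
        using False mover_Suc_eq[of k pl] by simp
    qed
  qed
  have "\<not> won opts (last ps)"
    using end_opts by (simp add: won_iff)
  then show ?thesis
    using inv[of "length ps - 1"] ne by (auto simp: wins_def last_conv_nth split: if_splits)
qed

lemma follows_snoc:
  assumes "ps \<noteq> []"
  shows "follows pl \<sigma> (ps @ [x]) \<longleftrightarrow>
    follows pl \<sigma> ps \<and> (mover (length ps - 1) = pl \<longrightarrow> x = \<sigma> ps)"
proof -
  obtain n where n: "length ps = Suc n"
    using assms by (cases "length ps") auto
  show ?thesis
    unfolding follows_def using n
    by (auto simp: nth_append less_Suc_eq all_conj_distrib imp_conjL)
qed

text \<open>Playing one strategy against the other must end. Any partial play is extended by
  well-founded induction on its last position. This is what rules out winning strategies for both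
  players.\<close>

lemma complete_play_exists:
  assumes "terminating opts"
    and strat: "\<And>pl. strategy opts (\<sigma> pl)"
  obtains ps where "complete_play opts g ps" "\<And>pl. follows pl (\<sigma> pl) ps"
proof -
  have "\<exists>qs. complete_play opts g qs \<and> (\<forall>pl. follows pl (\<sigma> pl) qs)"
    if "ps \<noteq> []" "hd ps = g" "successively (\<lambda>x y. y \<in> opts x) ps"
      "\<forall>pl. follows pl (\<sigma> pl) ps" "last ps = x" for ps x
    using assms(1)[unfolded terminating_def] that
  proof (induction x arbitrary: ps rule: wfp_induct_rule)
    case (less x)
    show ?case
    proof (cases "opts x = {}")
      case True
      then show ?thesis
        using less.prems by (auto simp: complete_play_def)
    next
      case False
      \<comment> \<open>A history of length \<open>n\<close> records \<open>n - 1\<close> moves, so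
        the next move has index \<open>length ps - 1\<close>.\<close>
      define y where "y = \<sigma> (mover (length ps - 1)) ps"
      have "y \<in> opts x"
        using strat False less.prems by (auto simp: strategy_def y_def)
      then show ?thesis
        using less.prems
        by (intro less.IH[of y "ps @ [y]"])
          (auto simp: successively_append_iff follows_snoc y_def)
    qed
  qed
  from this[of "[g]" g] show thesis
    using that by (auto simp: follows_def)
qed

text \<open>If the position were \<open>won\<close>, the optimal strategy for \<open>Next\<close>
  could be played against the winning strategy of \<open>Previous\<close>, and both players would
  win the resulting play.\<close>

lemma P_position_iff_lost:
  assumes "terminating opts"
  shows "P_position opts g \<longleftrightarrow> lost opts g"
proof
  assume "lost opts g"
  then have "wins Previous ps"
    if "complete_play opts g ps" "follows Previous (optimal_strategy opts) ps" for ps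
    using optimal_strategy_wins[OF that] by simp
  then show "P_position opts g"
    unfolding P_position_def has_winning_strategy_def
    using strategy_optimal_strategy by blast
next
  assume "P_position opts g"
  then obtain \<sigma> where \<sigma>: "strategy opts \<sigma>"
    "\<And>ps. complete_play opts g ps \<Longrightarrow> follows Previous \<sigma> ps \<Longrightarrow> wins Previous ps"
    by (auto simp: P_position_def has_winning_strategy_def)
  show "lost opts g"
  proof (rule ccontr)
    assume "\<not> lost opts g"
    then have won: "won opts g"
      using won_iff_not_lost[OF assms] by simp
    define \<tau> where "\<tau> pl = (if pl = Next then optimal_strategy opts else \<sigma>)" for pl
    have "strategy opts (\<tau> pl)" for pl
      using \<sigma>(1) by (simp add: \<tau>_def strategy_optimal_strategy)
    then obtain ps where ps: "complete_play opts g ps" "\<And>pl. follows pl (\<tau> pl) ps"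
      using complete_play_exists[OF assms, of \<tau>] by blast
    have "wins Next ps"
      using optimal_strategy_wins[OF ps(1)] ps(2)[of Next] won by (simp add: \<tau>_def)
    moreover have "wins Previous ps"
      using \<sigma>(2) ps(1) ps(2)[of Previous] by (simp add: \<tau>_def)
    ultimately show False
      by (cases "mover (length ps - 1)") (auto simp: wins_def)
  qed
qed

lemma P_position_iff:
  assumes "terminating opts"
  shows "P_position opts g \<longleftrightarrow> (\<forall>h\<in>opts g. \<not> P_position opts h)"
  using won_iff_not_lost[OF assms] lost_iff[of opts g] by (simp add: P_position_iff_lost[OF assms])

section \<open>Termination\<close>

lemma strict_follower_trans:
  "strict_follower opts g h \<Longrightarrow> strict_follower opts h k \<Longrightarrow> strict_follower opts g k"
  by (simp add: strict_follower_def)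

lemma strict_follower_opts: "h \<in> opts g \<Longrightarrow> strict_follower opts g h"
  by (auto simp: strict_follower_def)

lemma wfp_strict_follower:
  assumes "terminating opts"
  shows "wfp (\<lambda>h g. strict_follower opts g h)"
proof -
  \<comment> \<open>Well-foundedness has the option as first argument,
    \<open>strict_follower\<close> as second; taking converses commutes with transitive
    closure.\<close>
  have "(\<lambda>h g. h \<in> opts g) = (\<lambda>g h. h \<in> opts g)\<inverse>\<inverse>"
    by (simp add: fun_eq_iff)
  then have "(\<lambda>h g. h \<in> opts g)\<^sup>+\<^sup>+ = (\<lambda>h g. strict_follower opts g h)"
    by (simp only: tranclp_converse strict_follower_def) (simp add: fun_eq_iff)
  then show ?thesis
    using assms by (metis terminating_def wfp_tranclp)
qed

text \<open>Once the sequence reaches a minimal element of its range, no later term can be a strict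
  follower of it, so every later step is stationary.\<close>

lemma eventually_constant:
  fixes x :: "nat \<Rightarrow> 'p"
  assumes "terminating opts"
    and step: "\<And>i. x (Suc i) = x i \<or> strict_follower opts (x i) (x (Suc i))"
  obtains i where "\<And>j. i \<le> j \<Longrightarrow> x j = x i"
proof -
  have "wf {(h, g). strict_follower opts g h}"
    using wfp_strict_follower[OF assms(1)] by (simp add: wfp_def)
  then obtain z where "z \<in> range x" "\<And>y. strict_follower opts z y \<Longrightarrow> y \<notin> range x"
    by (rule wfE_min'[where Q = "range x"]) auto
  then obtain i where i: "\<And>j. \<not> strict_follower opts (x i) (x j)"
    by auto
  have "x j = x i" if "i \<le> j" for j
    using that
  proof (induction j rule: dec_induct)
    case (step j)
    then show ?case
      using assms(2)[of j] i[of "Suc j"] by auto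
  qed simp
  then show thesis
    by (rule that)
qed

text \<open>In an infinite play each component eventually stops changing. The finitely many
  components have a common index after which all are constant, yet every move must change the tuple.
  Limits are used because plays of a terminating game can have unbounded length, so a rank in the
  naturals may fail to exist.\<close>

lemma terminating_emperor_opts:
  assumes "finite V" and "\<Delta> \<subseteq> Pow V" and "\<And>v. v \<in> V \<Longrightarrow> terminating (opts v)"
  shows "terminating (emperor_opts V \<Delta> opts)"
  unfolding terminating_def wfp_def wf_iff_no_infinite_down_chain
proof
  assume "\<exists>f. \<forall>i. (f (Suc i), f i) \<in> {(x, y). x \<in> emperor_opts V \<Delta> opts y}"
  then obtain f where f: "\<And>i. f (Suc i) \<in> emperor_opts V \<Delta> opts (f i)"
    by auto
  have "f (Suc i) v = f i v \<or> strict_follower (opts v) (f i v) (f (Suc i) v)"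
    if "v \<in> V" for v i
    using f[of i] that strict_follower_opts[of "f (Suc i) v" "opts v" "f i v"]
    by (auto simp: emperor_opts_def)
  then have "\<exists>i. \<forall>j\<ge>i. f j v = f i v" if "v \<in> V" for v
    using eventually_constant[OF assms(3)[OF that], of "\<lambda>i. f i v"] that by metis
  then obtain s where s: "\<And>v j. v \<in> V \<Longrightarrow> s v \<le> j \<Longrightarrow> f j v = f (s v) v"
    by metis
  obtain m where "\<And>v. v \<in> V \<Longrightarrow> s v \<le> m"
    using \<open>finite V\<close> by (meson finite_imageI finite_nat_set_iff_bounded_le imageI)
  then have "f (Suc m) v = f m v" if "v \<in> V" for v
    using s[OF that] that by (metis le_SucI)
  moreover have "f (Suc m) v = f m v" if "v \<notin> V" for v
    using f[of m] that by (auto simp: emperor_opts_def)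
  ultimately have "f (Suc m) = f m"
    by blast
  then show False
    using f[of m] by (simp add: emperor_opts_def)
qed

text \<open>The total number of stones on \<open>V\<close> drops with every move, because the
  non-empty face lies inside \<open>V\<close>.\<close>

lemma terminating_nim_opts:
  assumes "finite V" and "\<Delta> \<subseteq> Pow V"
  shows "terminating (nim_opts \<Delta>)"
  unfolding terminating_def
proof (rule wfp_if_convertible_to_nat)
  fix a' a
  assume "a' \<in> nim_opts \<Delta> a"
  then obtain F where F: "F \<in> \<Delta>" "F \<noteq> {}" "\<And>v. v \<in> F \<Longrightarrow> a' v < a v"
    "\<And>v. v \<notin> F \<Longrightarrow> a' v = a v"
    by (auto simp: nim_opts_def)
  show "sum a' V < sum a V"
  proof (rule sum_strict_mono_ex1[OF \<open>finite V\<close>])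
    show "\<forall>v\<in>V. a' v \<le> a v"
      using F by (metis less_imp_le order_refl)
    show "\<exists>v\<in>V. a' v < a v"
      using F assms(2) by blast
  qed
qed

section \<open>Lengths\<close>

lemma Pl_well_defined_strict_follower:
  "Pl_well_defined opts g \<Longrightarrow> strict_follower opts g h \<Longrightarrow> Pl_well_defined opts h"
  unfolding Pl_well_defined_def by (meson strict_follower_trans)

lemma Pl_P_followers:
  assumes "terminating opts" "Pl_well_defined opts g" "opts g \<noteq> {}"
  shows "\<exists>h\<in>P_followers opts g. Pl opts g = Suc (Pl opts h)"
    and "h \<in> P_followers opts g \<Longrightarrow> Pl opts h < Pl opts g"
proof -
  let ?S = "Pl opts ` P_followers opts g"
  have "\<exists>m\<in>?S. \<forall>n\<in>?S. n \<le> m"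
    using assms(2,3) unfolding Pl_well_defined_def by simp
  then obtain m where m: "m \<in> ?S" "\<And>n. n \<in> ?S \<Longrightarrow> n \<le> m"
    by (elim bexE) auto
  \<comment> \<open>The greatest element supplied by \<open>Pl_well_defined\<close> bounds this set
    of naturals; finiteness then makes \<open>Max\<close> that element.\<close>
  have "finite ?S"
    using m(2) unfolding finite_nat_set_iff_bounded_le by (intro exI[of _ m]) simp
  then have "Max ?S = m"
    using m by (intro Max_eqI)
  then have Pl: "Pl opts g = Suc m"
    using Pl_rec[OF assms(1), of g] assms(3) by simp
  show "\<exists>h\<in>P_followers opts g. Pl opts g = Suc (Pl opts h)"
    using Pl m(1) by auto
  show "Pl opts h < Pl opts g" if "h \<in> P_followers opts g"
    using Pl m(2) that by (simp add: less_Suc_eq_le)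
qed

lemma strict_follower_opts_nonempty: "strict_follower opts g h \<Longrightarrow> opts g \<noteq> {}"
  unfolding strict_follower_def by (auto dest: tranclpD)

lemma Pl_strict_follower_less:
  assumes "terminating opts" "Pl_well_defined opts g"
    and "strict_follower opts g h" "P_position opts h"
  shows "Pl opts h < Pl opts g"
  using Pl_P_followers(2)[OF assms(1,2) strict_follower_opts_nonempty[OF assms(3)]] assms(3,4)
  by (simp add: P_followers_def)

text \<open>Passing to a P-follower that attains the maximum lowers the length by exactly one.
  Iterating this descent therefore skips no value below \<open>Pl opts g\<close>.\<close>

lemma P_follower_with_Pl:
  assumes "terminating opts" "Pl_well_defined opts g" "b < Pl opts g"
  obtains h where "strict_follower opts g h" "P_position opts h" "Pl opts h = b"
proof -
  have "\<exists>h. strict_follower opts g h \<and> P_position opts h \<and> Pl opts h = b"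
    using assms(2,3)
  proof (induction "Pl opts g" arbitrary: g rule: less_induct)
    case less
    have "opts g \<noteq> {}"
      using less.prems(2) Pl_rec[OF assms(1), of g] by auto
    then obtain h where h: "strict_follower opts g h" "P_position opts h"
      "Pl opts g = Suc (Pl opts h)"
      using Pl_P_followers(1)[OF assms(1) less.prems(1)] by (auto simp: P_followers_def)
    show ?case
    proof (cases "b = Pl opts h")
      case True
      then show ?thesis using h by blast
    next
      case False
      then have "\<exists>k. strict_follower opts h k \<and> P_position opts k \<and> Pl opts k = b"
        using less.prems h by (intro less.hyps) (auto intro: Pl_well_defined_strict_follower)
      then show ?thesis
        using h(1) strict_follower_trans by metis
    qed
  qed
  then show thesis
    using that by blast
qed

section \<open>The kernel of the emperor sum\<close>

locale emperor_sum =
  fixes V :: "'v set" and \<Delta> :: "'v set set" and opts :: "'v \<Rightarrow> 'p \<Rightarrow> 'p set"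
  assumes finite_V: "finite V"
    and complex: "simplicial_complex_on V \<Delta>"
    and opts_terminating: "v \<in> V \<Longrightarrow> terminating (opts v)"
begin

lemma subset_Pow: "\<Delta> \<subseteq> Pow V"
  using complex by (simp add: simplicial_complex_on_def)

lemma nim_P_positions_iff: "a \<in> nim_P_positions \<Delta> \<longleftrightarrow> nim_opts \<Delta> a \<inter> nim_P_positions \<Delta> = {}"
  using P_position_iff[OF terminating_nim_opts[OF finite_V subset_Pow], of a]
  by (auto simp: nim_P_positions_def)

text \<open>Off \<open>V\<close> the games need not terminate and the values may be meaningless, but
  a move leaves them unchanged, as a nim move does.\<close>

definition lengths :: "('v \<Rightarrow> 'p) \<Rightarrow> 'v \<Rightarrow> nat" where
  "lengths g = (\<lambda>v. Pl (opts v) (g v))"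

definition kernel :: "('v \<Rightarrow> 'p) set" where
  "kernel = {g. lengths g \<in> nim_P_positions \<Delta> \<and> (\<forall>v\<in>V. P_position (opts v) (g v))}"

lemma kernel_independent:
  assumes wd: "\<And>v. v \<in> V \<Longrightarrow> Pl_well_defined (opts v) (g v)"
    and g: "g \<in> kernel" and g': "g' \<in> emperor_opts V \<Delta> opts g"
  shows "g' \<notin> kernel"
proof
  assume "g' \<in> kernel"
  with g have P: "P_position (opts v) (g v)" "P_position (opts v) (g' v)" if "v \<in> V" for v
    using that by (auto simp: kernel_def)
  from g' obtain F where F: "F \<in> \<Delta>" "g' \<noteq> g" "\<And>v. v \<notin> V \<Longrightarrow> g' v = g v"
    "\<And>v. v \<in> F \<Longrightarrow> g' v = g v \<or> strict_follower (opts v) (g v) (g' v)"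
    "\<And>v. v \<in> V - F \<Longrightarrow> g' v = g v \<or> g' v \<in> opts v (g v)"
    by (auto simp: emperor_opts_def)
  have FV: "F \<subseteq> V"
    using F(1) subset_Pow by blast
  have outside: "g' v = g v" if "v \<notin> F" for v
    using F(3,5)[of v] P[of v] P_position_iff[OF opts_terminating, of v "g v"] that by blast
  \<comment> \<open>The emperor face \<open>F\<close> may contain vertices that stay put, while a
    nim move must decrease every vertex of its face. The set of changed vertices is again a face by
    closure under subsets.\<close>
  define F' where "F' = {v. g' v \<noteq> g v}"
  have "F' \<subseteq> F"
    using outside by (auto simp: F'_def)
  then have "F' \<in> \<Delta>"
    using F(1) complex by (auto simp: simplicial_complex_on_def)
  moreover have "F' \<noteq> {}"
    using F(2) by (auto simp: F'_def)
  moreover have "lengths g' v < lengths g v" if "v \<in> F'" for v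
  proof -
    have "v \<in> F" "v \<in> V" "strict_follower (opts v) (g v) (g' v)"
      using that \<open>F' \<subseteq> F\<close> FV F(4)[of v] by (auto simp: F'_def)
    then show ?thesis
      unfolding lengths_def using Pl_strict_follower_less[OF opts_terminating wd] P(2) by blast
  qed
  moreover have "lengths g' v = lengths g v" if "v \<notin> F'" for v
    using that by (simp add: F'_def lengths_def)
  ultimately have "lengths g' \<in> nim_opts \<Delta> (lengths g)"
    by (auto simp: nim_opts_def)
  then show False
    using g \<open>g' \<in> kernel\<close> nim_P_positions_iff[of "lengths g"] by (auto simp: kernel_def)
qed

lemma kernel_absorbing:
  assumes wd: "\<And>v. v \<in> V \<Longrightarrow> Pl_well_defined (opts v) (g v)"
    and g: "g \<notin> kernel"
  shows "emperor_opts V \<Delta> opts g \<inter> kernel \<noteq> {}"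
proof -
  define N where "N = {v\<in>V. \<not> P_position (opts v) (g v)}"
  have "\<exists>h. h \<in> opts v (g v) \<and> P_position (opts v) h" if "v \<in> N" for v
    using that P_position_iff[OF opts_terminating, of v "g v"] by (auto simp: N_def)
  then obtain c where c: "\<And>v. v \<in> N \<Longrightarrow> c v \<in> opts v (g v) \<and> P_position (opts v) (c v)"
    by metis
  \<comment> \<open>One move repairs every N-component. This uses only the single moves allowed on
    all vertices, so a face remains available for adjusting lengths.\<close>
  define h where "h v = (if v \<in> N then c v else g v)" for v
  have h_step: "h v = g v \<or> h v \<in> opts v (g v)" for v
    using c by (auto simp: h_def)
  have h_P: "P_position (opts v) (h v)" if "v \<in> V" for v
    using c that by (auto simp: h_def N_def)
  have h_outside: "h v = g v" if "v \<notin> V" for v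
    using that by (auto simp: h_def N_def)
  show ?thesis
  proof (cases "lengths h \<in> nim_P_positions \<Delta>")
    case True
    then have "h \<in> kernel"
      using h_P by (simp add: kernel_def)
    have "h \<noteq> g"
      using \<open>h \<in> kernel\<close> g by blast
    \<comment> \<open>Making at most one move everywhere is legal with the empty face. That it is a
      face needs \<open>\<Delta>\<close> to be non-empty, which a vertex in \<open>V\<close>
      guarantees.\<close>
    then obtain v where "v \<in> V"
      using h_outside by blast
    then have "{} \<in> \<Delta>"
      using complex by (auto simp: simplicial_complex_on_def)
    then have "h \<in> emperor_opts V \<Delta> opts g"
      using \<open>h \<noteq> g\<close> h_step h_outside by (auto simp: emperor_opts_def)
    then show ?thesis
      using \<open>h \<in> kernel\<close> by blast
  next
    case False
    then obtain b F where b: "b \<in> nim_P_positions \<Delta>" and F: "F \<in> \<Delta>" "F \<noteq> {}"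
      and b_less: "\<And>v. v \<in> F \<Longrightarrow> b v < lengths h v"
      and b_eq: "\<And>v. v \<notin> F \<Longrightarrow> b v = lengths h v"
      using nim_P_positions_iff[of "lengths h"] by (auto simp: nim_opts_def)
    have FV: "F \<subseteq> V"
      using F(1) subset_Pow by blast
    \<comment> \<open>On \<open>F\<close> the target is sought directly among the followers of
      \<open>g v\<close>, not of \<open>h v\<close>. This works because \<open>h v\<close> is
      \<open>g v\<close> or a P-position option of it, so its length is at most that of
      \<open>g v\<close>, and \<open>b v\<close> lies strictly below.\<close>
    have "\<exists>k. strict_follower (opts v) (g v) k \<and> P_position (opts v) k \<and> Pl (opts v) k = b v"
      if "v \<in> F" for v
    proof -
      have v: "v \<in> V"
        using that FV by blast
      have "lengths h v \<le> lengths g v"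
        using h_step[of v] Pl_strict_follower_less[OF opts_terminating[OF v] wd[OF v], of "h v"] h_P[OF v]
          strict_follower_opts[of "h v" "opts v" "g v"]
        by (auto simp: lengths_def)
      then have "b v < Pl (opts v) (g v)"
        using b_less[OF that] by (simp add: lengths_def)
      then show ?thesis
        using P_follower_with_Pl[OF opts_terminating[OF v] wd[OF v]] by metis
    qed
    then obtain k where k: "\<And>v. v \<in> F \<Longrightarrow> strict_follower (opts v) (g v) (k v)"
      "\<And>v. v \<in> F \<Longrightarrow> P_position (opts v) (k v)" "\<And>v. v \<in> F \<Longrightarrow> Pl (opts v) (k v) = b v"
      by metis
    \<comment> \<open>The two stages merge into one emperor move: arbitrary descent on
      \<open>F\<close>, at most one move elsewhere. It is not the empty move, because
      \<open>g'\<close> lies in the kernel and \<open>g\<close> does not.\<close>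
    define g' where "g' v = (if v \<in> F then k v else h v)" for v
    have "lengths g' = b"
      using k(3) b_eq by (auto simp: lengths_def g'_def)
    then have "g' \<in> kernel"
      using b k(2) h_P by (auto simp: kernel_def g'_def)
    moreover have "g' \<noteq> g"
      using \<open>g' \<in> kernel\<close> g by blast
    then have "g' \<in> emperor_opts V \<Delta> opts g"
      using F(1) FV k(1) h_step h_outside unfolding emperor_opts_def g'_def
      by (intro CollectI conjI bexI[of _ F]) auto
    ultimately show ?thesis
      by blast
  qed
qed

text \<open>Independence and absorption determine a set of positions uniquely in a terminating game.
  The induction along emperor moves can proceed because well-defined lengths are inherited by
  followers in each component.\<close>

lemma P_position_iff_kernel:
  assumes "\<And>v. v \<in> V \<Longrightarrow> Pl_well_defined (opts v) (g v)"
  shows "P_position (emperor_opts V \<Delta> opts) g \<longleftrightarrow> g \<in> kernel"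
proof -
  have term_emperor: "terminating (emperor_opts V \<Delta> opts)"
    using finite_V subset_Pow opts_terminating by (rule terminating_emperor_opts)
  from term_emperor[unfolded terminating_def] assms show ?thesis
  proof (induction g rule: wfp_induct_rule)
    case (less g)
    have "Pl_well_defined (opts v) (g' v)" if "g' \<in> emperor_opts V \<Delta> opts g" "v \<in> V" for g' v
    proof -
      have "g' v = g v \<or> strict_follower (opts v) (g v) (g' v)"
        using that strict_follower_opts[of "g' v" "opts v" "g v"] by (auto simp: emperor_opts_def)
      then show ?thesis
        using less.prems[OF \<open>v \<in> V\<close>] Pl_well_defined_strict_follower by metis
    qed
    then have IH: "P_position (emperor_opts V \<Delta> opts) g' \<longleftrightarrow> g' \<in> kernel"
      if "g' \<in> emperor_opts V \<Delta> opts g" for g'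
      using less.IH that by blast
    show ?case
      using P_position_iff[OF term_emperor, of g] IH kernel_independent[OF less.prems]
        kernel_absorbing[OF less.prems]
      by blast
  qed
qed

end

theorem theorem2:
  fixes V :: "'v set" and \<Delta> :: "'v set set"
    and opts :: "'v \<Rightarrow> 'p \<Rightarrow> 'p set" and g :: "'v \<Rightarrow> 'p"
  assumes "finite V"
    and "simplicial_complex_on V \<Delta>"
    and "\<And>v. v \<in> V \<Longrightarrow> terminating (opts v)"
    and "\<And>v. v \<in> V \<Longrightarrow> Pl_well_defined (opts v) (g v)"
  shows "P_position (emperor_opts V \<Delta> opts) g \<longleftrightarrow>
    (\<lambda>v. Pl (opts v) (g v)) \<in> nim_P_positions \<Delta> \<and> (\<forall>v\<in>V. P_position (opts v) (g v))"
proof -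
  interpret emperor_sum V \<Delta> opts
    using assms(1-3) by unfold_locales
  show ?thesis
    using P_position_iff_kernel[OF assms(4)] by (simp add: kernel_def lengths_def)
qed

end
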